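(* Let $S$ be a semiring, $M$ a monoid, and $k\ge 2$ an integer. Then the following statements hold: (1) If $s$ is a multiplicatively $k$-potent element of $S$ and $m$ is a $k$-potent element of $M$, then $sX^m$ is a multiplicatively $k$-potent element of $S[M]$. (2) If each element of the finite family $\{s_i\}_{i=1}^n \subseteq S$ is multiplicatively $k$-potent and $s_i s_j = 0$ for all $i\neq j$, then $\sum_{i=1}^{n} s_i$ is also multiplicatively $k$-potent. (3) If for each $1\leq i \leq n$, $s_i\in S$ is multiplicatively $k$-potent, $s_i s_j = 0$ for all $1 \leq i < j \leq n$, and for each $1\leq i \leq n$, $m_i\in M$ is $k$-potent, then $\sum_{i=1}^{n} s_i X^{m_i}$ is a multiplicatively $k$-potent element of $S[M]$. (4) If $\{m_i\}_{i=1}^n$ (with the $m_i$ pairwise distinct) is a subgroup of the monoid $M$ and $n\cdot 1=\sum_{i=1}^{n} 1$ is a unit in $S$, then $\displaystyle \frac{\sum_{i=1}^{n} X^{m_i}}{n\cdot 1}$ is a multiplicatively idempotent element of $S[M]$.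
   Context: A semiring is a set $S$ with operations $+,\cdot$ such that $(S,+,0)$ and $(S,\cdot,1)$ are commutative monoids with $1\neq 0$, multiplication distributes over addition, and $s\cdot 0=0$ for all $s$. A unit of $S$ is an element $s$ with $st=1$ for some $t\in S$. An element $x$ of a semiring is multiplicatively $k$-potent if $x^k=x$, and multiplicatively idempotent if $x^2=x$. All monoids are commutative and written additively; $m\in M$ is $k$-potent if $k\cdot m=m$ (the $k$-fold sum of $m$). A subgroup of $M$ is a subset that is a group under the operation of $M$. $S[M]$ is the monoid semiring, whose elements are finite formal sums $\sum_i s_iX^{m_i}$ with $s_i\in S$, $m_i\in M$, and $X^mX^{m'}=X^{m+m'}$. Division by the unit $n\cdot 1$ means multiplication by its inverse in $S$. *)

theory Defs
  imports "HOL-Library.Poly_Mapping" "HOL-Algebra.Group"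
begin

text \<open>
  The semiring \<open>S\<close> is a type of class \<^class>\<open>comm_semiring_1\<close> (which includes \<open>0 \<noteq> 1\<close>), the monoid
  \<open>M\<close> a type of class \<^class>\<open>comm_monoid_add\<close>, and \<open>S[M]\<close> is the type \<open>'m \<Rightarrow>\<^sub>0 's\<close> of finitely
  supported functions with convolution product; \<open>s X\<^sup>m\<close> is \<open>Poly_Mapping.single m s\<close>.
\<close>

definition mult_potent :: "nat \<Rightarrow> 'a::monoid_mult \<Rightarrow> bool" where
  "mult_potent k x \<longleftrightarrow> x ^ k = x"

definition mult_idempotent :: "'a::monoid_mult \<Rightarrow> bool" where
  "mult_idempotent x \<longleftrightarrow> x\<^sup>2 = x"

definition add_potent :: "nat \<Rightarrow> 'm::comm_monoid_add \<Rightarrow> bool" where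
  "add_potent k m \<longleftrightarrow> (\<Sum>i<k. m) = m"

text \<open>The neutral element \<open>e\<close> of a subgroup of a monoid need not be the \<open>0\<close> of the monoid.\<close>

definition subgroup_of_monoid :: "'m::comm_monoid_add set \<Rightarrow> bool" where
  "subgroup_of_monoid H \<longleftrightarrow> (\<exists>e. group \<lparr>carrier = H, monoid.mult = (+), one = e\<rparr>)"

definition unit_inverse :: "'s::comm_semiring_1 \<Rightarrow> 's" where
  "unit_inverse u = (THE t. u * t = 1)"

lemma unit_inverse_unique:
  fixes u t :: "'s::comm_semiring_1"
  assumes "u * t = 1"
  shows "unit_inverse u = t"
  unfolding unit_inverse_def
proof (rule the_equality)
  fix t' assume "u * t' = 1"
  then have "t' = (u * t) * t'" using assms by simp
  also have "\<dots> = t * (u * t')" by (simp only: ac_simps)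
  finally show "t' = t" using \<open>u * t' = 1\<close> by simp
qed (fact assms)

lemma unit_inverse_right:
  fixes u :: "'s::comm_semiring_1"
  assumes "u dvd 1"
  shows "u * unit_inverse u = 1"
  using assms by (metis dvd_def unit_inverse_unique)

end

theory Submission
  imports Defs
begin

text \<open>Powers of a monomial are computed separately in coefficient and exponent:
  \<open>(s X^m)^k = s^k X^(k m)\<close>. Hence potency of \<open>s\<close> and \<open>m\<close>
  passes to \<open>s X^m\<close>. For pairwise orthogonal elements all cross terms of a power
  vanish, so a positive power of the sum is the sum of the powers
  (\<open>orthogonal_sum_power\<close>). Monomials with orthogonal coefficients are themselves
  orthogonal, so the third claim combines the first two. For a finite subgroup \<open>H\<close>, put
  \<sigma> = sum of \<open>X^h\<close> over \<open>H\<close>. Each \<open>h\<close> in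
  \<open>H\<close> permutes \<open>H\<close> by translation, so \<open>X^h\<close> fixes \<sigma>
  and \<sigma>^2 = |H| \<sigma> (\<open>subgroup_sum_square\<close>). Dividing \<sigma> by |H|
  therefore yields an idempotent.\<close>

lemma single_power:
  fixes m :: "'m::comm_monoid_add" and s :: "'s::comm_semiring_1"
  shows "Poly_Mapping.single m s ^ k = Poly_Mapping.single (\<Sum>i<k. m) (s ^ k)"
  by (induction k) (simp_all add: mult_single ac_simps)

lemma mult_potent_single:
  fixes m :: "'m::comm_monoid_add" and s :: "'s::comm_semiring_1"
  assumes "mult_potent k s" "add_potent k m"
  shows "mult_potent k (Poly_Mapping.single m s)"
  using assms by (simp add: mult_potent_def add_potent_def single_power)

text \<open>Multiplying the sum of the powers by \<open>f i\<close> leaves only the term at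
  \<open>i\<close>, since every other term has a factor \<open>f j\<close> orthogonal to
  \<open>f i\<close>. The exponent is \<open>Suc k\<close> because for exponent 0 the left side is
  1, while the right side counts the elements of \<open>A\<close>.\<close>

lemma orthogonal_sum_power:
  fixes f :: "'i \<Rightarrow> 'a::comm_semiring_1"
  assumes "finite A"
    and orth: "\<And>i j. i \<in> A \<Longrightarrow> j \<in> A \<Longrightarrow> i \<noteq> j \<Longrightarrow> f i * f j = 0"
  shows "(\<Sum>i\<in>A. f i) ^ Suc k = (\<Sum>i\<in>A. f i ^ Suc k)"
proof (induction k)
  case (Suc k)
  have "f i * (\<Sum>j\<in>A. f j ^ Suc k) = f i ^ Suc (Suc k)" if "i \<in> A" for i
  proof -
    have "f i * f j ^ Suc k = (if j = i then f i ^ Suc (Suc k) else 0)" if "j \<in> A" for j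
      \<comment> \<open>Reassociating brings \<open>f i * f j\<close> together at the front of the
        product, where orthogonality applies.\<close>
      using orth[OF \<open>i \<in> A\<close> that] by (auto simp flip: mult.assoc)
    then have "f i * (\<Sum>j\<in>A. f j ^ Suc k) = (\<Sum>j\<in>A. if j = i then f i ^ Suc (Suc k) else 0)"
      unfolding sum_distrib_left by (intro sum.cong) auto
    then show ?thesis
      using \<open>finite A\<close> \<open>i \<in> A\<close> by simp
  qed
  then show ?case
    by (subst power_Suc, subst Suc.IH) (simp add: sum_distrib_right del: power_Suc)
qed simp

lemma mult_potent_orthogonal_sum:
  fixes f :: "'i \<Rightarrow> 'a::comm_semiring_1"
  assumes "finite A" "k > 0"
    and "\<And>i. i \<in> A \<Longrightarrow> mult_potent k (f i)"
    and "\<And>i j. i \<in> A \<Longrightarrow> j \<in> A \<Longrightarrow> i \<noteq> j \<Longrightarrow> f i * f j = 0"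
  shows "mult_potent k (\<Sum>i\<in>A. f i)"
proof -
  obtain l where "k = Suc l"
    using \<open>k > 0\<close> gr0_implies_Suc by blast
  then show ?thesis
    using assms orthogonal_sum_power[of A f l] by (simp add: mult_potent_def)
qed

text \<open>The ambient monoid may fail to be cancellative, but cancellation holds inside the group
  \<open>H\<close>. Translation is thus an injective self-map of a finite set, hence onto.\<close>

lemma subgroup_of_monoid_translate:
  assumes "subgroup_of_monoid H" "finite H" "h \<in> H"
  shows "bij_betw ((+) h) H H"
proof -
  obtain e where "group \<lparr>carrier = H, monoid.mult = (+), one = e\<rparr>"
    using assms(1) by (auto simp: subgroup_of_monoid_def)
  then interpret G: group "\<lparr>carrier = H, monoid.mult = (+), one = e\<rparr>" .
  have "inj_on ((+) h) H"
    using G.inj_on_cmult[of h] \<open>h \<in> H\<close> by simp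
  moreover have "(+) h ` H \<subseteq> H"
    using G.m_closed[of h] \<open>h \<in> H\<close> by auto
  ultimately show ?thesis
    using \<open>finite H\<close> by (simp add: bij_betw_def endo_inj_surj)
qed

text \<open>Translation by \<open>h\<close> only reorders the terms of \<sigma>, so
  \<open>X^h\<close> \<sigma> = \<sigma>. Expanding the first factor of \<sigma> * \<sigma> then
  gives one copy of \<sigma> for each element of \<open>H\<close>.\<close>

lemma subgroup_sum_square:
  fixes H :: "'m::comm_monoid_add set"
  defines "\<sigma> \<equiv> (\<Sum>h\<in>H. Poly_Mapping.single h (1::'s::comm_semiring_1))"
  assumes "subgroup_of_monoid H" "finite H"
  shows "\<sigma> * \<sigma> = of_nat (card H) * \<sigma>"
proof -
  have "Poly_Mapping.single h 1 * \<sigma> = \<sigma>" if "h \<in> H" for h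
    using sum.reindex_bij_betw[OF subgroup_of_monoid_translate[OF assms(2,3) that],
        of "\<lambda>g. Poly_Mapping.single g (1::'s)"]
    by (simp add: \<sigma>_def sum_distrib_left mult_single)
  then have "(\<Sum>h\<in>H. Poly_Mapping.single h 1 * \<sigma>) = of_nat (card H) * \<sigma>"
    by simp
  then show ?thesis
    by (simp add: \<sigma>_def sum_distrib_right)
qed

lemma mult_idempotent_subgroup_average:
  fixes H :: "'m::comm_monoid_add set"
  assumes "subgroup_of_monoid H" "finite H" "(of_nat (card H) :: 's::comm_semiring_1) dvd 1"
  shows "mult_idempotent
    (Poly_Mapping.single 0 (unit_inverse (of_nat (card H) :: 's)) * (\<Sum>h\<in>H. Poly_Mapping.single h 1))"
proof -
  let ?c = "Poly_Mapping.single 0 (unit_inverse (of_nat (card H) :: 's)) :: 'm \<Rightarrow>\<^sub>0 's"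
  let ?\<sigma> = "\<Sum>h\<in>H. Poly_Mapping.single h (1::'s)"
  \<comment> \<open>The numeral \<open>of_nat (card H)\<close> of \<open>S[M]\<close> is the
    constant \<open>single 0 (of_nat (card H))\<close>, so the inverse taken in \<open>S\<close>
    also inverts it in \<open>S[M]\<close>.\<close>
  have "of_nat (card H) * ?c = 1"
    using unit_inverse_right[OF assms(3)] by (simp add: mult_single flip: single_of_nat)
  moreover have "(?c * ?\<sigma>)\<^sup>2 = ?c * ?c * (?\<sigma> * ?\<sigma>)"
    by (simp add: power2_eq_square ac_simps)
  \<comment> \<open>Squaring \<sigma> produces a factor |H|, which cancels one of the two factors
    \<open>?c\<close>.\<close>
  then have "(?c * ?\<sigma>)\<^sup>2 = (of_nat (card H) * ?c) * (?c * ?\<sigma>)"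
    by (simp add: subgroup_sum_square[OF assms(1,2)] ac_simps)
  ultimately show ?thesis
    by (simp add: mult_idempotent_def)
qed

theorem proposition6p1:
  fixes k :: nat
  assumes "k \<ge> 2"
  shows
    "(\<forall>(s::'s::comm_semiring_1) (m::'m::comm_monoid_add). mult_potent k s \<and> add_potent k m
        \<longrightarrow> mult_potent k (Poly_Mapping.single m s))
   \<and> (\<forall>(n::nat) (s::nat \<Rightarrow> 's).
        (\<forall>i\<in>{1..n}. mult_potent k (s i))
        \<and> (\<forall>i\<in>{1..n}. \<forall>j\<in>{1..n}. i \<noteq> j \<longrightarrow> s i * s j = 0)
        \<longrightarrow> mult_potent k (\<Sum>i=1..n. s i))
   \<and> (\<forall>(n::nat) (s::nat \<Rightarrow> 's) (m::nat \<Rightarrow> 'm).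
        (\<forall>i\<in>{1..n}. mult_potent k (s i))
        \<and> (\<forall>i\<in>{1..n}. \<forall>j\<in>{1..n}. i < j \<longrightarrow> s i * s j = 0)
        \<and> (\<forall>i\<in>{1..n}. add_potent k (m i))
        \<longrightarrow> mult_potent k (\<Sum>i=1..n. Poly_Mapping.single (m i) (s i)))
   \<and> (\<forall>(n::nat) (m::nat \<Rightarrow> 'm).
        inj_on m {1..n} \<and> subgroup_of_monoid (m ` {1..n})
        \<and> (of_nat n :: 's) dvd 1
        \<longrightarrow> mult_idempotent
              (Poly_Mapping.single 0 (unit_inverse (of_nat n :: 's))
               * (\<Sum>i=1..n. Poly_Mapping.single (m i) 1)))"
proof (intro conjI allI impI; elim conjE)
  fix s :: 's and m :: 'm
  assume "mult_potent k s" "add_potent k m"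
  then show "mult_potent k (Poly_Mapping.single m s)"
    by (rule mult_potent_single)
next
  fix n :: nat and s :: "nat \<Rightarrow> 's"
  assume "\<forall>i\<in>{1..n}. mult_potent k (s i)"
    and "\<forall>i\<in>{1..n}. \<forall>j\<in>{1..n}. i \<noteq> j \<longrightarrow> s i * s j = 0"
  then show "mult_potent k (\<Sum>i=1..n. s i)"
    using assms by (intro mult_potent_orthogonal_sum) auto
next
  fix n :: nat and s :: "nat \<Rightarrow> 's" and m :: "nat \<Rightarrow> 'm"
  assume potent: "\<forall>i\<in>{1..n}. mult_potent k (s i)" "\<forall>i\<in>{1..n}. add_potent k (m i)"
    and orth: "\<forall>i\<in>{1..n}. \<forall>j\<in>{1..n}. i < j \<longrightarrow> s i * s j = 0"
  \<comment> \<open>Orthogonality is given only for \<open>i < j\<close>; commutativity supplies the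
    opposite order.\<close>
  have "s i * s j = 0" if "i \<in> {1..n}" "j \<in> {1..n}" "i \<noteq> j" for i j
    using orth that by (metis mult.commute nat_neq_iff)
  then show "mult_potent k (\<Sum>i=1..n. Poly_Mapping.single (m i) (s i))"
    using assms potent
    by (intro mult_potent_orthogonal_sum mult_potent_single) (auto simp: mult_single)
next
  fix n :: nat and m :: "nat \<Rightarrow> 'm"
  assume inj: "inj_on m {1..n}" and "subgroup_of_monoid (m ` {1..n})" "(of_nat n :: 's) dvd 1"
  \<comment> \<open>Since the \<open>m i\<close> are distinct, \<open>n\<close> is the order of the
    subgroup and the indexed sum is the sum over its elements.\<close>
  moreover have "card (m ` {1..n}) = n"
    using inj by (simp add: card_image)
  moreover have "(\<Sum>h\<in>m ` {1..n}. Poly_Mapping.single h (1::'s)) = (\<Sum>i=1..n. Poly_Mapping.single (m i) 1)"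
    using inj by (simp add: sum.reindex)
  ultimately show "mult_idempotent
      (Poly_Mapping.single 0 (unit_inverse (of_nat n :: 's)) * (\<Sum>i=1..n. Poly_Mapping.single (m i) 1))"
    using mult_idempotent_subgroup_average[of "m ` {1..n}", where 's = 's] by simp
qed

end
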